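(* Let $\delta>0$ and $y^\delta$ be fixed and $1<\tau<\lambda$. Let $m_k\to\infty$, and let $\{\alpha_k\}_{k\in\mathbb{N}}$ and $\{x^\delta_{m_k,\alpha_k}\}_{k\in\mathbb{N}}$ be sequences such that $\alpha_k\to\widetilde\alpha$ and $x^\delta_{m_k,\alpha_k}\rightharpoonup\widetilde x$ (weakly), where for each $k$, $\alpha_k>0$ and $x^\delta_{m_k,\alpha_k}$ is a minimizer of $\mathcal{F}^{y^\delta}_{\alpha_k,x_0}$ over $\mathcal{D}_{m_k}$. Assume that for each $k$ $$\tau\delta\le\|F(x^\delta_{m_k,\alpha_k})-y^\delta\|\le\lambda\delta .$$ Then $\widetilde x$ is a minimizer over $\mathcal{D}(F)$ of the Tikhonov functional $\mathcal{F}^{y^\delta}_{\widetilde\alpha,x_0}$ with regularization parameter $\widetilde\alpha$, and it satisfies $$\tau\delta\le\|F(\widetilde x)-y^\delta\|\le\lambda\delta .$$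
   Context: Setting. $X,Y$ are reflexive Banach spaces, $F:\mathcal{D}(F)\subset X\to Y$ has convex domain $\mathcal{D}(F)$, $y\in\mathcal{R}(F)$ is the noiseless data, $y^\delta\in Y$ is noisy data with noise level $\delta>0$, $\|y-y^\delta\|\le\delta$; $1\le p<\infty$; $x_0\in\mathcal{D}(F)$ is fixed. $\mathcal{F}^{y^\delta}_{\alpha,x_0}(x)=\|F(x)-y^\delta\|^p+\alpha f_{x_0}(x)$. Standing assumptions. (1) $f_{x_0}:\mathcal{D}(f_{x_0})\to\mathbb{R}_+$ is weakly lower semi-continuous, convex, coercive and proper, and $\mathcal{D}(F)$ lies in the interior of $\mathcal{D}(f_{x_0})$. (2) $F$ is continuous for the strong topologies; the level sets $\mathcal{M}_\alpha(\rho)=\{x\in\mathcal{D}(F):\mathcal{F}^{y^\delta}_{\alpha,x_0}(x)\le\rho\}$ are weakly pre-compact and weakly closed, and $F$ restricted to $\mathcal{M}_\alpha(\rho)$ is continuous for the weak topologies of $X$ and $Y$. (3) If $x^\dagger$ is an $f_{x_0}$-minimizing solution then $\liminf_{t\to0^+}\|F((1-t)x^\dagger+tx_0)-y\|^p/t=0$. Here $\mathcal{LS}=\{x\in\mathcal{D}(F):\|F(x)-y\|=0\}$, and an $f_{x_0}$-minimizing solution is an element of $\mathcal{L}=\operatorname{argmin}\{f_{x_0}(x):x\in\mathcal{LS}\}$; it is assumed that $\mathcal{L}\ne\emptyset$. (4) $f_{x_0}(x)=0$ if and only if $x=x_0$. Discretization. $\{X_m\}_{m\in\mathbb{N}}$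 are finite-dimensional subspaces of $X$ with $X_m\subset X_{m+1}$ and $\overline{\bigcup_m X_m}=X$; $\mathcal{D}_m=\mathcal{D}(F)\cap X_m$, assumed nonempty for every $m$. There is $m_0$ with $x_0\in\mathcal{D}_{m_0}$ and only $m\ge m_0$ are considered.
   Formalization: The formal theorem additionally assumes that the union of the discretized domains D_m = D(F) ∩ X_m is dense in D(F); without this the claim fails, e.g. when D(F) is a segment meeting every X_m only in x_0. *)

theory Defs
  imports "HOL-Analysis.Analysis"
begin

text \<open>The scalar field is \<open>\<real>\<close>; the dual of \<open>'a\<close> is the type \<open>'a \<Rightarrow>\<^sub>L real\<close> of bounded linear functionals.
  Reflexivity says that the canonical map into the bidual is onto.\<close>

definition reflexive_space :: "'a::real_normed_vector itself \<Rightarrow> bool" where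
  "reflexive_space T \<longleftrightarrow>
     (\<forall>\<Phi> :: ('a \<Rightarrow>\<^sub>L real) \<Rightarrow>\<^sub>L real. \<exists>x::'a. \<forall>g. blinfun_apply \<Phi> g = blinfun_apply g x)"

definition weak_topology :: "'a::real_normed_vector topology" where
  "weak_topology = topology_generated_by {blinfun_apply g -` U | (g :: 'a \<Rightarrow>\<^sub>L real) U. open U}"

lemma topspace_weak_topology [simp]: "topspace weak_topology = UNIV"
proof -
  have "UNIV = blinfun_apply (0 :: 'a \<Rightarrow>\<^sub>L real) -` UNIV" by simp
  then have "(UNIV :: 'a set) \<in> {blinfun_apply g -` U | (g :: 'a \<Rightarrow>\<^sub>L real) U. open U}"
    using open_UNIV by blast
  then show ?thesis
    unfolding weak_topology_def topology_generated_by_topspace by blast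
qed

lemma limitin_weak_topology:
  "limitin weak_topology x l A \<longleftrightarrow> (\<forall>g :: 'a::real_normed_vector \<Rightarrow>\<^sub>L real. ((\<lambda>i. g (x i)) \<longlongrightarrow> g l) A)"
  (is "?L \<longleftrightarrow> ?R")
proof
  assume L: ?L
  show ?R
  proof (intro allI topological_tendstoI)
    fix g :: "'a \<Rightarrow>\<^sub>L real" and S assume S: "open S" "g l \<in> S"
    have "openin weak_topology (blinfun_apply g -` S)"
      unfolding weak_topology_def by (rule topology_generated_by_Basis) (use S in blast)
    with L S show "\<forall>\<^sub>F i in A. g (x i) \<in> S"
      unfolding limitin_def by fastforce
  qed
next
  assume R: ?R
  have "\<forall>\<^sub>F i in A. x i \<in> U" if "openin weak_topology U" "l \<in> U" for U
  proof -
    have "generate_topology_on {blinfun_apply g -` U | (g :: 'a \<Rightarrow>\<^sub>L real) U. open U} U"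
      using that unfolding weak_topology_def openin_topology_generated_by_iff by simp
    then show ?thesis using that(2)
    proof induction
      case (UN K)
      then obtain k where "k \<in> K" "l \<in> k" by blast
      with UN.IH have "\<forall>\<^sub>F i in A. x i \<in> k" by blast
      then show ?case by (rule eventually_mono) (use \<open>k \<in> K\<close> in blast)
    next
      case (Basis s)
      then obtain g :: "'a \<Rightarrow>\<^sub>L real" and V where "s = blinfun_apply g -` V" "open V" by blast
      with R Basis show ?case by (auto dest: topological_tendstoD)
    qed (auto elim: eventually_elim2)
  qed
  then show ?L by (simp add: limitin_def)
qed

text \<open>The functions are real-valued on an explicit effective domain \<open>S\<close>, so lower semi-continuity
  is relative to \<open>S\<close> with the topology induced on it.\<close>

definition weakly_lsc_on :: "'a::real_normed_vector set \<Rightarrow> ('a \<Rightarrow> real) \<Rightarrow> bool" where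
  "weakly_lsc_on S f \<longleftrightarrow> (\<forall>c. closedin (subtopology weak_topology S) {x \<in> S. f x \<le> c})"

definition coercive_on :: "'a::real_normed_vector set \<Rightarrow> ('a \<Rightarrow> real) \<Rightarrow> bool" where
  "coercive_on S f \<longleftrightarrow> filterlim f at_top (inf at_infinity (principal S))"

definition weakly_precompact :: "'a::real_normed_vector set \<Rightarrow> bool" where
  "weakly_precompact S \<longleftrightarrow> compactin weak_topology (weak_topology closure_of S)"

definition finite_dim_subspace :: "'a::real_vector set \<Rightarrow> bool" where
  "finite_dim_subspace S \<longleftrightarrow> (\<exists>B. finite B \<and> S = span B)"

definition tikhonov ::
  "('a \<Rightarrow> 'b::real_normed_vector) \<Rightarrow> ('a \<Rightarrow> real) \<Rightarrow> 'b \<Rightarrow> real \<Rightarrow> real \<Rightarrow> 'a \<Rightarrow> real" where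
  "tikhonov F f z p \<alpha> x = norm (F x - z) powr p + \<alpha> * f x"

definition tikhonov_level_set ::
  "('a \<Rightarrow> 'b::real_normed_vector) \<Rightarrow> 'a set \<Rightarrow> ('a \<Rightarrow> real) \<Rightarrow> 'b \<Rightarrow> real \<Rightarrow> real \<Rightarrow> real \<Rightarrow> 'a set" where
  "tikhonov_level_set F D f z p \<alpha> \<rho> = {x \<in> D. tikhonov F f z p \<alpha> x \<le> \<rho>}"

definition solutions :: "('a \<Rightarrow> 'b::real_normed_vector) \<Rightarrow> 'a set \<Rightarrow> 'b \<Rightarrow> 'a set" where
  "solutions F D y = {x \<in> D. norm (F x - y) = 0}"

definition minimizing_solutions ::
  "('a \<Rightarrow> 'b::real_normed_vector) \<Rightarrow> 'a set \<Rightarrow> ('a \<Rightarrow> real) \<Rightarrow> 'b \<Rightarrow> 'a set" where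
  "minimizing_solutions F D f y = {x. is_arg_min f (\<lambda>z. z \<in> solutions F D y) x}"

end

theory Submission
  imports Defs
begin

text \<open>Comparing the \<open>k\<close>-th discrete minimizer with points of \<open>\<Union>n. D \<inter> Xs n\<close> near \<open>z \<in> D\<close> shows that
  the minimal values are asymptotically at most the value of the limit functional at \<open>z\<close>; this uses
  that the penalty, being convex and lower semi-continuous on a Banach space, is norm continuous in
  the interior of its domain. Taking for \<open>z\<close> a solution rules out \<open>\<alpha>lim = 0\<close>, because the lower
  discrepancy bound exceeds the noise level. Hence the penalties are bounded, the minimizers lie in
  one level set, and both terms of the functional are lower semi-continuous along the sequence. This
  gives minimality of the limit; taking \<open>z = xlim\<close> shows that each term converges separately, so
  the discrepancy bounds are preserved.\<close>

section \<open>Norming functionals\<close>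

text \<open>Scaling is demanded only as an inequality, which is easy to check for an infimum of such
  functions; equality for \<open>c \<ge> 0\<close> follows by scaling back with
  \<open>inverse c\<close>.\<close>

definition sublinear :: "('a::real_vector \<Rightarrow> real) \<Rightarrow> bool" where
  "sublinear q \<longleftrightarrow> (\<forall>x y. q (x + y) \<le> q x + q y) \<and> (\<forall>c x. 0 \<le> c \<longrightarrow> q (c *\<^sub>R x) \<le> c * q x)"

lemma sublinear_add: "sublinear q \<Longrightarrow> q (x + y) \<le> q x + q y"
  by (simp add: sublinear_def)

lemma sublinear_0:
  assumes "sublinear q"
  shows "q 0 = 0"
proof -
  have "q (0 *\<^sub>R 0) \<le> 0 * q 0"
    using assms unfolding sublinear_def by blast
  moreover have "q 0 \<le> q 0 + q 0"
    using sublinear_add[OF assms, of 0 0] by simp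
  ultimately show ?thesis by simp
qed

lemma sublinear_scale:
  assumes "sublinear q" "0 \<le> c"
  shows "q (c *\<^sub>R x) = c * q x"
proof (cases "c = 0")
  case False
  with assms have c: "c > 0" by simp
  have "q (inverse c *\<^sub>R (c *\<^sub>R x)) \<le> inverse c * q (c *\<^sub>R x)"
    using assms c unfolding sublinear_def by (meson inverse_nonnegative_iff_nonnegative)
  then have "c * q x \<le> q (c *\<^sub>R x)"
    using c by (simp add: field_simps)
  moreover have "q (c *\<^sub>R x) \<le> c * q x"
    using assms unfolding sublinear_def by blast
  ultimately show ?thesis by simp
qed (simp add: sublinear_0[OF assms(1)])

lemma sublinear_minus: "sublinear q \<Longrightarrow> - q (- x) \<le> q x"
  using sublinear_add[of q x "- x"] sublinear_0[of q] by simp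

lemma sublinear_norm: "sublinear norm"
  by (simp add: sublinear_def norm_triangle_ineq)

text \<open>Oddness turns subadditivity at \<open>- x\<close> and \<open>- y\<close> into the
  reverse inequality at \<open>x\<close> and \<open>y\<close>.\<close>

lemma sublinear_odd_imp_linear:
  assumes q: "sublinear q" and odd: "\<And>x. q (- x) \<le> - q x"
  shows "linear q"
proof -
  have minus: "q (- x) = - q x" for x
    using odd[of x] sublinear_minus[OF q, of x] by simp
  show ?thesis
  proof (rule linearI)
    fix x y
    show "q (x + y) = q x + q y"
      using sublinear_add[OF q, of x y] sublinear_add[OF q, of "- x" "- y"]
        minus[of x] minus[of y] minus[of "x + y"] by simp
  next
    fix c :: real and x
    show "q (c *\<^sub>R x) = c *\<^sub>R q x"
    proof (cases "0 \<le> c")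
      case False
      then show ?thesis
        using sublinear_scale[OF q, of "- c" x] minus[of "c *\<^sub>R x"] by simp
    qed (simp add: sublinear_scale[OF q])
  qed
qed

text \<open>Consequently a minimal sublinear function is odd, hence linear.\<close>

lemma sublinear_below:
  assumes q: "sublinear q"
  obtains r where "sublinear r" "r \<le> q" "r (- v) \<le> - q v"
proof -
  \<comment> \<open>\<open>r\<close> is the lowering of \<open>q\<close> in direction
    \<open>v\<close>: \<open>t = 0\<close> gives \<open>r \<le> q\<close>, and \<open>t = 1\<close>
    at the point \<open>- v\<close> gives \<open>r (- v) \<le> - q v\<close>.\<close>
  define h where "h x t = q (x + t *\<^sub>R v) - t * q v" for x t
  define r where "r x = (INF t\<in>{0..}. h x t)" for x
  \<comment> \<open>Splitting \<open>t *\<^sub>R v\<close> as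
    \<open>(x + t *\<^sub>R v) + (- x)\<close> gives a bound independent of \<open>t\<close>, so the
    infimum is a genuine real number.\<close>
  have lower: "- q (- x) \<le> h x t" if "0 \<le> t" for x t
    using sublinear_add[OF q, of "x + t *\<^sub>R v" "- x"] sublinear_scale[OF q that, of v]
    by (simp add: h_def)
  then have bdd: "bdd_below (h x ` {0..})" for x
    by (intro bdd_belowI2) auto
  have le: "r x \<le> h x t" if "0 \<le> t" for x t
    unfolding r_def using that by (intro cINF_lower[OF bdd]) auto
  have greatest: "b \<le> r x" if "\<And>t. 0 \<le> t \<Longrightarrow> b \<le> h x t" for b x
    unfolding r_def using that by (intro cINF_greatest) auto
  have "r (x + y) \<le> r x + r y" for x y
  proof -
    \<comment> \<open>The parameter \<open>s + t\<close> at \<open>x + y\<close> separates the two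
      sides, so the infima over \<open>t\<close> and \<open>s\<close> can be taken one after the
      other.\<close>
    have h: "r (x + y) \<le> h x s + h y t" if "0 \<le> s" "0 \<le> t" for s t
      using le[of "s + t" "x + y"] that
        sublinear_add[OF q, of "x + s *\<^sub>R v" "y + t *\<^sub>R v"]
      by (simp add: h_def algebra_simps)
    have "r (x + y) - h x s \<le> r y" if "0 \<le> s" for s
      using h[OF that] by (intro greatest) (simp add: algebra_simps)
    then have "r (x + y) - r y \<le> r x"
      by (intro greatest) (simp add: algebra_simps)
    then show ?thesis by simp
  qed
  moreover have "r (c *\<^sub>R x) \<le> c * r x" if "0 \<le> c" for c x
  proof (cases "c = 0")
    case True
    then show ?thesis
      using le[of 0 0] sublinear_0[OF q] by (simp add: h_def)
  next
    case False
    with that have c: "c > 0" by simp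
    have "r (c *\<^sub>R x) / c \<le> h x t" if "0 \<le> t" for t
    proof -
      have "h (c *\<^sub>R x) (c * t) = c * h x t"
        using sublinear_scale[OF q, of c "x + t *\<^sub>R v"] c by (simp add: h_def algebra_simps)
      then show ?thesis
        using le[of "c * t" "c *\<^sub>R x"] c that by (simp add: field_simps)
    qed
    then have "r (c *\<^sub>R x) / c \<le> r x" by (rule greatest)
    then show ?thesis using c by (simp add: field_simps)
  qed
  ultimately have "sublinear r" by (simp add: sublinear_def)
  moreover have "r \<le> q"
    using le[of 0] by (auto simp: le_fun_def h_def)
  moreover have "r (- v) \<le> - q v"
    using le[of 1 "- v"] sublinear_0[OF q] by (simp add: h_def)
  ultimately show thesis by (rule that)
qed

text \<open>A form of Hahn-Banach: Zorn's lemma is applied to the sublinear functions below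
  \<open>q\<close> instead of to partial extensions. A minimal one cannot be lowered in any
  direction, hence is odd and therefore linear.\<close>

lemma linear_below_sublinear:
  assumes q: "sublinear q"
  obtains g where "linear g" "g \<le> q"
proof -
  define A where "A = {r. sublinear r \<and> r \<le> q}"
  have "\<exists>m\<in>A. \<forall>a\<in>A. m \<ge> a \<longrightarrow> a = m"
  proof (rule predicate_Zorn)
    show "partial_order_on A (relation_of (\<ge>) A)"
      by (rule partial_order_on_relation_ofI) auto
  next
    fix C assume C: "C \<in> Chains (relation_of (\<ge>) A)"
    then have CA: "C \<subseteq> A" and tot: "\<And>a b. a \<in> C \<Longrightarrow> b \<in> C \<Longrightarrow> a \<le> b \<or> b \<le> a"
      by (auto simp: Chains_def relation_of_def)
    show "\<exists>u\<in>A. \<forall>a\<in>C. a \<ge> u"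
    proof (cases "C = {}")
      case True
      then show ?thesis using q by (auto simp: A_def)
    next
      case False
      define u where "u x = (INF a\<in>C. a x)" for x
      \<comment> \<open>Since \<open>a (- x) \<le> q (- x)\<close>, this bound is uniform over the
        chain, and the pointwise infimum exists.\<close>
      have "- q (- x) \<le> a x" if "a \<in> C" for a x
        using that CA sublinear_minus[of a x] le_funD[of a q "- x"] by (force simp: A_def)
      then have bdd: "bdd_below ((\<lambda>a. a x) ` C)" for x
        by (rule bdd_belowI2)
      have le: "u x \<le> a x" if "a \<in> C" for a x
        unfolding u_def using that by (intro cINF_lower[OF bdd])
      have greatest: "b \<le> u x" if "\<And>a. a \<in> C \<Longrightarrow> b \<le> a x" for b x
        unfolding u_def using that False by (intro cINF_greatest)
      have "u (x + y) \<le> u x + u y" for x y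
      proof -
        have "u (x + y) \<le> a x + b y" if ab: "a \<in> C" "b \<in> C" for a b
        proof -
          \<comment> \<open>Of two chain members one lies below the other; subadditivity of this
            single \<open>c\<close> gives the mixed inequality for \<open>a\<close> and
            \<open>b\<close>.\<close>
          obtain c where c: "c \<in> C" "c \<le> a" "c \<le> b"
            using tot[OF ab] ab by (metis order_refl)
          then have "c (x + y) \<le> c x + c y"
            using CA sublinear_add by (auto simp: A_def)
          with c le[of c "x + y"] show ?thesis
            by (smt (verit) le_funD)
        qed
        then have "u (x + y) - a x \<le> b y" if "a \<in> C" "b \<in> C" for a b
          using that by (simp add: diff_le_eq add.commute)
        then have "u (x + y) - a x \<le> u y" if "a \<in> C" for a
          using that by (intro greatest)
        then have "u (x + y) - u y \<le> u x"
          by (intro greatest) (simp add: algebra_simps)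
        then show ?thesis by simp
      qed
      moreover have "u (c *\<^sub>R x) \<le> c * u x" if "0 \<le> c" for c x
      proof -
        have le': "u (c *\<^sub>R x) \<le> c * a x" if "a \<in> C" for a
          using le[OF that, of "c *\<^sub>R x"] sublinear_scale[of a c x] that CA \<open>0 \<le> c\<close>
          by (auto simp: A_def)
        show ?thesis
        proof (cases "c = 0")
          case True
          then show ?thesis using le' False by auto
        next
          case False
          with \<open>0 \<le> c\<close> have "u (c *\<^sub>R x) / c \<le> u x"
            using le' by (intro greatest) (simp add: field_simps)
          with False \<open>0 \<le> c\<close> show ?thesis by (simp add: field_simps)
        qed
      qed
      ultimately have "sublinear u" by (simp add: sublinear_def)
      moreover obtain a where "a \<in> C" using False by blast
      then have "u \<le> a" "a \<le> q" using le CA by (auto simp: le_fun_def A_def)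
      then have "u \<le> q" by simp
      ultimately show ?thesis
        using le by (auto simp: A_def le_fun_def)
    qed
  qed
  then obtain g where g: "sublinear g" "g \<le> q"
    and minimal: "\<And>a. sublinear a \<Longrightarrow> a \<le> g \<Longrightarrow> a = g"
    unfolding A_def by (blast intro: order_trans)
  have "g (- x) \<le> - g x" for x
  proof -
    obtain a where a: "sublinear a" "a \<le> g" "a (- x) \<le> - g x"
      using sublinear_below[OF g(1)] .
    from a(3) show ?thesis
      unfolding minimal[OF a(1,2)] .
  qed
  then show thesis
    using that sublinear_odd_imp_linear g by blast
qed

text \<open>The norm is first lowered in direction \<open>v\<close>. A linear \<open>g\<close> below
  the result satisfies \<open>- g v = g (- v) \<le> - norm v\<close>, which forces equality at
  \<open>v\<close>.\<close>

lemma norming_functional: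
  fixes v :: "'a::real_normed_vector"
  obtains g :: "'a \<Rightarrow>\<^sub>L real" where "\<And>x. blinfun_apply g x \<le> norm x" "blinfun_apply g v = norm v"
proof -
  obtain r where r: "sublinear r" "r \<le> norm" "r (- v) \<le> - norm v"
    using sublinear_below[OF sublinear_norm] .
  obtain g where g: "linear g" "g \<le> r"
    using linear_below_sublinear[OF r(1)] .
  have le: "g x \<le> norm x" for x
    using g(2) r(2) by (meson le_funD order_trans)
  have "bounded_linear g"
  proof (rule bounded_linear_intro[where K = 1])
    show "norm (g x) \<le> norm x * 1" for x
      using le[of x] le[of "- x"] linear_neg[OF g(1), of x] by simp
  qed (simp_all add: linear_add[OF g(1)] linear_scale[OF g(1)])
  moreover have "g v = norm v"
    using le[of v] linear_neg[OF g(1), of v] le_funD[OF g(2), of "- v"] r(3) by simp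
  ultimately show thesis
    using le that[of "Blinfun g"] by (simp add: bounded_linear_Blinfun_apply)
qed

text \<open>A norming functional at \<open>l - z\<close> attains the norm there and stays below the
  norm along \<open>u\<close>, so convergence of its values suffices: the norm is weakly lower
  semi-continuous.\<close>

lemma weak_limit_norm_lower:
  assumes lim: "limitin weak_topology u l A" and c: "c < norm (l - z)"
  shows "\<forall>\<^sub>F i in A. c < norm (u i - z)"
proof -
  obtain g where le: "\<And>x. blinfun_apply g x \<le> norm x" and eq: "blinfun_apply g (l - z) = norm (l - z)"
    using norming_functional[of "l - z"] by blast
  have "((\<lambda>i. g (u i)) \<longlongrightarrow> g l) A"
    using lim by (simp add: limitin_weak_topology)
  then have "((\<lambda>i. g (u i - z)) \<longlongrightarrow> g (l - z)) A"
    unfolding blinfun.diff_right by (intro tendsto_diff tendsto_const)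
  then have "\<forall>\<^sub>F i in A. c < g (u i - z)"
    using c eq by (auto dest: order_tendstoD)
  then show ?thesis
    by eventually_elim (use le in \<open>meson less_le_trans\<close>)
qed

section \<open>Weak lower semi-continuity and convexity\<close>

lemma openin_weak_imp_open:
  assumes "openin weak_topology U"
  shows "open U"
proof -
  have "generate_topology_on {blinfun_apply g -` V | (g :: 'a \<Rightarrow>\<^sub>L real) V. open V} U"
    using assms unfolding weak_topology_def openin_topology_generated_by_iff by simp
  then show ?thesis
  proof induction
    case (Basis s)
    then show ?case
      by (auto intro!: open_vimage continuous_intros)
  qed auto
qed

lemma weakly_lsc_on_lower:
  assumes f: "weakly_lsc_on S f"
    and lim: "limitin weak_topology u l A" "l \<in> S" "\<forall>\<^sub>F i in A. u i \<in> S"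
    and c: "c < f l"
  shows "\<forall>\<^sub>F i in A. c < f (u i)"
proof -
  have "closedin (subtopology weak_topology S) {x \<in> S. f x \<le> c}"
    using f by (simp add: weakly_lsc_on_def)
  then have "openin (subtopology weak_topology S) (S - {x \<in> S. f x \<le> c})"
    by (auto simp: closedin_def)
  moreover have "limitin (subtopology weak_topology S) u l A"
    using lim by (simp add: limitin_subtopology)
  ultimately have "\<forall>\<^sub>F i in A. u i \<in> S - {x \<in> S. f x \<le> c}"
    using lim(2) c unfolding limitin_def by fastforce
  then show ?thesis by eventually_elim auto
qed

text \<open>A weakly open set is norm open, so the set that witnesses relative weak openness of the
  complement also serves for the norm topology of any smaller \<open>T\<close>.\<close>

lemma weakly_lsc_on_imp_closedin:
  assumes f: "weakly_lsc_on S f" and TS: "T \<subseteq> S"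
  shows "closedin (top_of_set T) {x \<in> T. f x \<le> c}"
proof -
  obtain U where U: "openin weak_topology U" "S - {x \<in> S. f x \<le> c} = U \<inter> S"
    using f unfolding weakly_lsc_on_def closedin_def by (auto simp: openin_subtopology)
  have "T - {x \<in> T. f x \<le> c} = T \<inter> U"
    using U(2) TS by blast
  then show ?thesis
    using openin_weak_imp_open[OF U(1)] by (auto simp: closedin_def openin_open)
qed

text \<open>Baire's theorem: countably many relatively closed sublevel sets cover the completely
  metrizable space \<open>S\<close>, so one of them has interior points.\<close>

lemma lsc_bounded_above_on_ball:
  fixes f :: "'a::banach \<Rightarrow> real"
  assumes S: "open S" "S \<noteq> {}"
    and closed: "\<And>c. closedin (top_of_set S) {x \<in> S. f x \<le> c}"
  obtains r a b where "0 < r" "ball a r \<subseteq> S" "\<forall>x\<in>ball a r. f x \<le> b"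
proof -
  define L where "L n = {x \<in> S. f x \<le> real n}" for n
  have "\<exists>n. top_of_set S interior_of L n \<noteq> {}"
  proof (rule ccontr)
    assume "\<not> ?thesis"
    moreover have "completely_metrizable_space (top_of_set S)"
      using S by (simp add: completely_metrizable_space_openin completely_metrizable_space_euclidean)
    ultimately have "top_of_set S interior_of (\<Union>(range L)) = {}"
      using closed by (intro Baire_category_alt) (auto simp: L_def)
    moreover have "\<Union>(range L) = S"
      using real_arch_simple by (auto simp: L_def)
    ultimately show False
      using S by (metis interior_of_topspace topspace_euclidean_subtopology)
  qed
  then obtain n a where a: "a \<in> top_of_set S interior_of L n" by blast
  have "open (top_of_set S interior_of L n)"
    using S openin_interior_of openin_open_trans by blast
  then obtain r where "r > 0" "ball a r \<subseteq> top_of_set S interior_of L n"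
    using a by (auto simp: open_contains_ball)
  moreover have "top_of_set S interior_of L n \<subseteq> L n"
    by (rule interior_of_subset)
  ultimately show thesis
    by (intro that[of r a "real n"]) (auto simp: L_def)
qed

text \<open>Each \<open>x\<close> in \<open>S\<close> lies between \<open>a\<close> and some
  \<open>y\<close> in \<open>S\<close>. A homothety with centre \<open>y\<close> carries the ball
  around \<open>a\<close> to one around \<open>x\<close>, and convexity carries the upper bound
  along; reflection in \<open>x\<close> then supplies a lower bound.\<close>

lemma convex_on_locally_bounded:
  fixes f :: "'a::real_normed_vector \<Rightarrow> real"
  assumes S: "open S" and f: "convex_on S f"
    and ball: "0 < r" "ball a r \<subseteq> S" "\<forall>x\<in>ball a r. f x \<le> b" and x: "x \<in> S"
  obtains e B where "0 < e" "ball x e \<subseteq> S" "\<forall>z\<in>ball x e. \<bar>f z\<bar> \<le> B"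
proof -
  have "((\<lambda>t. x + t *\<^sub>R (x - a)) \<longlongrightarrow> x + 0 *\<^sub>R (x - a)) (at_right 0)"
    by (intro tendsto_intros)
  then have "\<forall>\<^sub>F t in at_right 0. x + t *\<^sub>R (x - a) \<in> S"
    using S x by (auto dest: topological_tendstoD)
  moreover have "\<forall>\<^sub>F t in at_right (0::real). 0 < t"
    by (simp add: eventually_at_right_less)
  ultimately have "\<forall>\<^sub>F t in at_right 0. 0 < t \<and> x + t *\<^sub>R (x - a) \<in> S"
    by eventually_elim simp
  then obtain t where t: "0 < t" "x + t *\<^sub>R (x - a) \<in> S"
    using eventually_happens'[OF trivial_limit_at_right_real] by blast
  \<comment> \<open>\<open>y\<close> lies slightly beyond \<open>x\<close> on the ray from
    \<open>a\<close>, and \<open>s\<close> is the weight of \<open>a\<close> when \<open>x\<close>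
    is written as a convex combination of \<open>y\<close> and \<open>a\<close>.\<close>
  define y where "y = x + t *\<^sub>R (x - a)"
  define s where "s = t / (1 + t)"
  have s: "0 < s" "s < 1" using t by (auto simp: s_def)
  have xs: "x = (1 - s) *\<^sub>R y + s *\<^sub>R a"
  proof -
    have "(1 - s) *\<^sub>R y + s *\<^sub>R a = x + ((1 - s) * t - s) *\<^sub>R (x - a)"
      by (simp add: y_def algebra_simps)
    moreover have "(1 - s) * t - s = 0" using t by (simp add: s_def field_simps)
    ultimately show ?thesis by simp
  qed
  obtain e where e: "0 < e" "ball x e \<subseteq> S"
    using S x open_contains_ball by blast
  \<comment> \<open>The homothety shrinks radii by the factor \<open>s\<close>; the bound
    \<open>e\<close> keeps the ball inside \<open>S\<close>.\<close>
  define d where "d = min e (s * r)"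
  define M where "M = \<bar>f y\<bar> + \<bar>b\<bar>"
  have d: "0 < d" "ball x d \<subseteq> S" using e s ball(1) by (auto simp: d_def)
  have upper: "f z \<le> M" if z: "z \<in> ball x d" for z
  proof -
    \<comment> \<open>The preimage of \<open>z\<close> under the homothety with centre
      \<open>y\<close> and ratio \<open>s\<close>.\<close>
    define w where "w = a + (1 / s) *\<^sub>R (z - x)"
    have "dist a w = norm (z - x) / s"
      using s by (simp add: w_def dist_norm)
    also have "\<dots> < r"
      using z s by (simp add: d_def dist_norm norm_minus_commute field_simps)
    finally have w: "w \<in> ball a r" by simp
    have "z = (1 - s) *\<^sub>R y + s *\<^sub>R w"
      using s by (subst add_diff_cancel_left'[of x z, symmetric])
        (simp add: w_def scaleR_add_right xs[symmetric] add.assoc[symmetric])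
    then have "f z \<le> (1 - s) * f y + s * f w"
      using convex_onD[OF f, of s y w] s t w ball(2) by (auto simp: y_def)
    also have "\<dots> \<le> 1 * \<bar>f y\<bar> + 1 * \<bar>b\<bar>"
    proof (rule add_mono)
      have "(1 - s) * f y \<le> (1 - s) * \<bar>f y\<bar>"
        using s by (intro mult_left_mono) auto
      also have "\<dots> \<le> 1 * \<bar>f y\<bar>"
        using s by (intro mult_right_mono) auto
      finally show "(1 - s) * f y \<le> 1 * \<bar>f y\<bar>" .
      have "s * f w \<le> s * \<bar>b\<bar>"
        using s bspec[OF ball(3) w] by (intro mult_left_mono) auto
      also have "\<dots> \<le> 1 * \<bar>b\<bar>"
        using s by (intro mult_right_mono) auto
      finally show "s * f w \<le> 1 * \<bar>b\<bar>" .
    qed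
    finally show ?thesis by (simp add: M_def)
  qed
  have "\<bar>f z\<bar> \<le> M + 2 * \<bar>f x\<bar>" if z: "z \<in> ball x d" for z
  proof -
    \<comment> \<open>The reflection of \<open>z\<close> in \<open>x\<close>: the midpoint
      inequality gives \<open>f z \<ge> 2 * f x - f z'\<close>, and \<open>f z'\<close> is bounded
      above.\<close>
    define z' where "z' = 2 *\<^sub>R x - z"
    have z': "z' \<in> ball x d"
      using z by (simp add: z'_def dist_norm norm_minus_commute scaleR_2)
    have "x = (1 - 1 / 2) *\<^sub>R z + (1 / 2) *\<^sub>R z'"
      by (simp add: z'_def algebra_simps)
    then have "f x \<le> (1 - 1 / 2) * f z + (1 / 2) * f z'"
      using convex_onD[OF f, of "1 / 2" z z'] subsetD[OF d(2) z] subsetD[OF d(2) z'] by simp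
    then show ?thesis
      using upper[OF z] upper[OF z'] by (simp add: field_simps)
  qed
  then show thesis
    using that d by blast
qed

text \<open>Baire bounds \<open>f\<close> above on one ball, convexity spreads boundedness to a ball
  around every point, and a bounded convex function on an open ball is continuous.\<close>

lemma convex_on_lsc_continuous:
  fixes f :: "'a::banach \<Rightarrow> real"
  assumes S: "open S" and f: "convex_on S f"
    and closed: "\<And>c. closedin (top_of_set S) {x \<in> S. f x \<le> c}"
  shows "continuous_on S f"
proof (cases "S = {}")
  case False
  obtain r a b where ball: "0 < r" "ball a r \<subseteq> S" "\<forall>x\<in>ball a r. f x \<le> b"
    by (rule lsc_bounded_above_on_ball[OF S False closed])
  have "isCont f x" if x: "x \<in> S" for x
  proof -
    obtain e B where e: "0 < e" "ball x e \<subseteq> S" "\<forall>z\<in>ball x e. \<bar>f z\<bar> \<le> B"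
      by (rule convex_on_locally_bounded[OF S f ball x])
    then have "continuous_on (ball x e) f"
      by (intro convex_on_bounded_continuous[where b = B] convex_on_subset[OF f]) auto
    then show ?thesis
      using e(1) by (simp add: continuous_on_eq_continuous_at)
  qed
  then show ?thesis
    by (simp add: continuous_at_imp_continuous_on)
qed simp

section \<open>The limit of the discrete minimizers\<close>

theorem proposition3:
  fixes F :: "'a::banach \<Rightarrow> 'b::banach" and D :: "'a set"
    and f :: "'a \<Rightarrow> real" and Df :: "'a set"
    and x0 :: 'a and y ydelta :: 'b
    and p \<delta> \<tau> lam \<alpha>lim :: real
    and Xs :: "nat \<Rightarrow> 'a set" and m0 :: nat
    and m :: "nat \<Rightarrow> nat" and \<alpha> :: "nat \<Rightarrow> real"
    and x :: "nat \<Rightarrow> 'a" and xlim :: 'a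
  assumes reflexive: "reflexive_space TYPE('a)" "reflexive_space TYPE('b)"
    and p: "1 \<le> p"
    and domain: "convex D" "x0 \<in> D"
    and data: "y \<in> F ` D" "0 < \<delta>" "norm (y - ydelta) \<le> \<delta>"
    and penalty: "\<And>z. z \<in> Df \<Longrightarrow> 0 \<le> f z"
      "weakly_lsc_on Df f" "convex_on Df f" "coercive_on Df f" "Df \<noteq> {}"
      "D \<subseteq> interior Df"
    and F_cont: "continuous_on D F"
    and level_sets: "\<And>a \<rho>. 0 < a \<Longrightarrow> 0 < \<rho> \<Longrightarrow>
        weakly_precompact (tikhonov_level_set F D f ydelta p a \<rho>)"
      "\<And>a \<rho>. 0 < a \<Longrightarrow> 0 < \<rho> \<Longrightarrow>
        closedin weak_topology (tikhonov_level_set F D f ydelta p a \<rho>)"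
      "\<And>a \<rho>. 0 < a \<Longrightarrow> 0 < \<rho> \<Longrightarrow>
        continuous_map (subtopology weak_topology (tikhonov_level_set F D f ydelta p a \<rho>))
          weak_topology F"
    and solution_limit: "\<And>xd. xd \<in> minimizing_solutions F D f y \<Longrightarrow>
        Liminf (at_right 0)
          (\<lambda>t::real. ereal (norm (F ((1 - t) *\<^sub>R xd + t *\<^sub>R x0) - y) powr p / t)) = 0"
    and solution_exists: "minimizing_solutions F D f y \<noteq> {}"
    and penalty_zero: "\<And>z. z \<in> Df \<Longrightarrow> f z = 0 \<longleftrightarrow> z = x0"
    and discretization: "\<And>n. finite_dim_subspace (Xs n)" "\<And>n. Xs n \<subseteq> Xs (Suc n)"
      "closure (\<Union>n. Xs n) = UNIV" "\<And>n. D \<inter> Xs n \<noteq> {}" "x0 \<in> D \<inter> Xs m0"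
      "D \<subseteq> closure (\<Union>n. D \<inter> Xs n)"
    and tau_lambda: "1 < \<tau>" "\<tau> < lam"
    and m: "filterlim m at_top sequentially" "\<And>k. m0 \<le> m k"
    and \<alpha>: "\<And>k. 0 < \<alpha> k" "\<alpha> \<longlonglongrightarrow> \<alpha>lim"
    and x: "limitin weak_topology x xlim sequentially"
      "\<And>k. is_arg_min (tikhonov F f ydelta p (\<alpha> k)) (\<lambda>z. z \<in> D \<inter> Xs (m k)) (x k)"
    and discrepancy:
      "\<And>k. \<tau> * \<delta> \<le> norm (F (x k) - ydelta) \<and> norm (F (x k) - ydelta) \<le> lam * \<delta>"
  shows "is_arg_min (tikhonov F f ydelta p \<alpha>lim) (\<lambda>z. z \<in> D) xlim \<and>
    \<tau> * \<delta> \<le> norm (F xlim - ydelta) \<and> norm (F xlim - ydelta) \<le> lam * \<delta>"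
proof -

  \<comment> \<open>Norm continuity of the penalty and of the limit functional\<close>
  have convex_continuous: "continuous_on D f"
  proof -
    have "continuous_on (interior Df) f"
    proof (rule convex_on_lsc_continuous)
      show "convex_on (interior Df) f"
        using penalty(3) interior_subset
        by (rule convex_on_subset) (use penalty(3) in \<open>auto simp: convex_on_def intro: convex_interior\<close>)
      show "closedin (top_of_set (interior Df)) {x \<in> interior Df. f x \<le> c}" for c
        using penalty(2) interior_subset by (rule weakly_lsc_on_imp_closedin)
    qed simp
    then show ?thesis using penalty(6) by (rule continuous_on_subset)
  qed
  have DDf: "D \<subseteq> Df" using penalty(6) interior_subset by blast
  have xD: "x k \<in> D" for k
    using x(2)[of k] by (simp add: is_arg_min_def)
  define A where "A k = norm (F (x k) - ydelta) powr p" for k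
  have tik: "tikhonov F f ydelta p (\<alpha> k) (x k) = A k + \<alpha> k * f (x k)" for k
    by (simp add: tikhonov_def A_def)
  have f_nonneg: "0 \<le> f (x k)" for k
    using penalty(1) DDf xD by blast
  have Xs_mono: "Xs i \<subseteq> Xs j" if "i \<le> j" for i j
    using that discretization(2) by (rule lift_Suc_mono_le[rotated])
  \<comment> \<open>A positive exponent keeps \<open>powr\<close> continuous also where the residual
    vanishes.\<close>
  have T_cont: "continuous_on D (tikhonov F f ydelta p \<alpha>lim)"
    unfolding tikhonov_def using p
    by (intro continuous_intros continuous_on_powr' F_cont convex_continuous) auto

  \<comment> \<open>Asymptotic upper bound for the discrete minimal values\<close>
  have asymptotic: "\<forall>\<^sub>F k in sequentially. A k + \<alpha> k * f (x k) < tikhonov F f ydelta p \<alpha>lim z + e"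
    if z: "z \<in> D" and e: "0 < e" for z e
  proof -
    obtain d where d: "0 < d" "\<And>w. w \<in> D \<Longrightarrow> dist w z < d \<Longrightarrow>
        dist (tikhonov F f ydelta p \<alpha>lim w) (tikhonov F f ydelta p \<alpha>lim z) < e"
      using T_cont z e unfolding continuous_on_iff by blast
    \<comment> \<open>The approximant must be admissible, hence the density in \<open>D\<close> of
      the sets \<open>D \<inter> Xs n\<close>.\<close>
    obtain w where w: "w \<in> (\<Union>n. D \<inter> Xs n)" "dist w z < d"
      using discretization(6) z d(1) unfolding closure_approachable subset_iff by blast
    then obtain n where wn: "w \<in> D" "w \<in> Xs n" by blast
    have "tikhonov F f ydelta p \<alpha>lim w < tikhonov F f ydelta p \<alpha>lim z + e"
      using d(2)[OF wn(1) w(2)] by (simp add: dist_real_def)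
    \<comment> \<open>With \<open>w\<close> fixed, only the regularization parameter varies.\<close>
    moreover have "(\<lambda>k. tikhonov F f ydelta p (\<alpha> k) w) \<longlonglongrightarrow> tikhonov F f ydelta p \<alpha>lim w"
      unfolding tikhonov_def by (intro tendsto_intros \<alpha>(2))
    ultimately have "\<forall>\<^sub>F k in sequentially. tikhonov F f ydelta p (\<alpha> k) w
        < tikhonov F f ydelta p \<alpha>lim z + e"
      by (auto dest: order_tendstoD)
    moreover have "\<forall>\<^sub>F k in sequentially. n \<le> m k"
      using m(1) by (simp add: filterlim_at_top)
    ultimately show ?thesis
    proof eventually_elim
      case (elim k)
      then have "\<not> tikhonov F f ydelta p (\<alpha> k) w < tikhonov F f ydelta p (\<alpha> k) (x k)"
        using x(2)[of k] wn Xs_mono[of n "m k"] by (auto simp: is_arg_min_def)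
      with elim show ?case by (simp add: tik)
    qed
  qed

  \<comment> \<open>Positivity of the limit parameter\<close>
  have \<alpha>lim_pos: "0 < \<alpha>lim"
  proof (rule ccontr)
    assume "\<not> 0 < \<alpha>lim"
    moreover have "0 \<le> \<alpha>lim"
      using \<alpha> by (intro LIMSEQ_le_const[OF \<alpha>(2)]) (auto intro: less_imp_le)
    ultimately have 0: "\<alpha>lim = 0" by simp
    obtain z where z: "z \<in> D" "F z = y" using data(1) by blast
    \<comment> \<open>The gap between the lower discrepancy bound and the noise level, both in
      \<open>p\<close>-th powers: with limit parameter 0, the asymptotic bound at a solution would
      push \<open>A k\<close> below \<open>(\<tau> * \<delta>) powr p\<close>.\<close>
    define e where "e = (\<tau> * \<delta>) powr p - \<delta> powr p"
    have "\<delta> powr p < (\<tau> * \<delta>) powr p"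
      using data(2) tau_lambda p by (intro powr_less_mono2) auto
    then have "0 < e" by (simp add: e_def)
    from eventually_happens'[OF sequentially_bot asymptotic[OF z(1) this]]
    obtain k where k: "A k + \<alpha> k * f (x k) < norm (y - ydelta) powr p + e"
      using 0 z by (auto simp: tikhonov_def)
    have "norm (y - ydelta) powr p \<le> \<delta> powr p"
      using data(3) p by (intro powr_mono2) auto
    moreover have "(\<tau> * \<delta>) powr p \<le> A k"
      unfolding A_def using discrepancy data(2) tau_lambda p by (intro powr_mono2) auto
    moreover have "0 \<le> \<alpha> k * f (x k)"
      using \<alpha>(1)[of k] f_nonneg[of k] by simp
    ultimately show False using k by (simp add: e_def)
  qed

  \<comment> \<open>A common level set and the weak limit of the images\<close>
  define C where "C = norm (F x0 - ydelta) powr p"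
  \<comment> \<open>\<open>C\<close> bounds \<open>\<alpha> k * f (x k)\<close>, by comparison with
    \<open>x0\<close>, where the penalty vanishes. Once \<open>\<alpha> k\<close> exceeds
    \<open>\<alpha>lim / 2\<close>, the penalty term with parameter \<open>\<alpha>lim\<close> is at
    most \<open>2 * C\<close>.\<close>
  define \<rho> where "\<rho> = (lam * \<delta>) powr p + 2 * C + 1"
  define M where "M = tikhonov_level_set F D f ydelta p \<alpha>lim \<rho>"
  have \<rho>: "0 < \<rho>" by (simp add: \<rho>_def C_def add_nonneg_pos)
  have penalty_bound: "\<alpha> k * f (x k) \<le> C" for k
  proof -
    have "x0 \<in> D \<inter> Xs (m k)"
      using discretization(5) Xs_mono[OF m(2)] by blast
    then have "\<not> tikhonov F f ydelta p (\<alpha> k) x0 < tikhonov F f ydelta p (\<alpha> k) (x k)"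
      using x(2)[of k] by (auto simp: is_arg_min_def)
    moreover have "f x0 = 0" using penalty_zero DDf domain(2) by blast
    moreover have "0 \<le> A k" by (simp add: A_def)
    ultimately show ?thesis by (simp add: tik) (simp add: tikhonov_def C_def)
  qed
  have "\<forall>\<^sub>F k in sequentially. \<alpha>lim / 2 < \<alpha> k"
    using order_tendstoD(1)[OF \<alpha>(2), of "\<alpha>lim / 2"] \<alpha>lim_pos by simp
  then have xM: "\<forall>\<^sub>F k in sequentially. x k \<in> M"
  proof eventually_elim
    case (elim k)
    then have "\<alpha>lim / 2 * f (x k) \<le> C"
      using penalty_bound[of k] f_nonneg[of k] mult_right_mono[of "\<alpha>lim / 2" "\<alpha> k" "f (x k)"] by simp
    moreover have "A k \<le> (lam * \<delta>) powr p"
      unfolding A_def using discrepancy p by (intro powr_mono2) auto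
    ultimately show ?case
      using xD[of k] by (simp add: M_def tikhonov_level_set_def tikhonov_def A_def \<rho>_def)
  qed
  have "xlim \<in> M"
    using x(1) level_sets(2)[OF \<alpha>lim_pos \<rho>] xM unfolding M_def
    by (rule limitin_closedin) simp
  then have xlimD: "xlim \<in> D" by (simp add: M_def tikhonov_level_set_def)
  \<comment> \<open>Weak continuity of \<open>F\<close> is given only relative to \<open>M\<close>,
    so both a tail of the sequence and its limit must lie there.\<close>
  have "limitin (subtopology weak_topology M) x xlim sequentially"
    using \<open>xlim \<in> M\<close> xM x(1) by (simp add: limitin_subtopology)
  then have F_lim: "limitin weak_topology (\<lambda>k. F (x k)) (F xlim) sequentially"
    using continuous_map_limit[OF level_sets(3)[OF \<alpha>lim_pos \<rho>]] by (simp add: M_def o_def)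

  \<comment> \<open>Lower semi-continuity of residual and penalty along the sequence\<close>
  define a where "a = norm (F xlim - ydelta) powr p"
  have tik_lim: "tikhonov F f ydelta p \<alpha>lim xlim = a + \<alpha>lim * f xlim"
    by (simp add: tikhonov_def a_def)
  have A_lower: "\<forall>\<^sub>F k in sequentially. c < A k" if c: "c < a" for c
  \<comment> \<open>Passing to the norm by \<open>p\<close>-th roots needs \<open>c \<ge> 0\<close>;
    a negative \<open>c\<close> lies below every \<open>A k\<close>.\<close>
  proof (cases "0 \<le> c")
    case True
    have "c powr (1 / p) < a powr (1 / p)"
      using True c p by (intro powr_less_mono2) auto
    also have "\<dots> = norm (F xlim - ydelta)"
      using p by (simp add: a_def powr_powr)
    finally have "\<forall>\<^sub>F k in sequentially. c powr (1 / p) < norm (F (x k) - ydelta)"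
      by (rule weak_limit_norm_lower[OF F_lim])
    then show ?thesis
    proof eventually_elim
      case (elim k)
      then have "(c powr (1 / p)) powr p < A k"
        unfolding A_def using p by (intro powr_less_mono2) auto
      then show ?case using True p by (simp add: powr_powr)
    qed
  next
    case False
    then have "c < A k" for k using powr_ge_zero[of "norm (F (x k) - ydelta)" p] unfolding A_def by linarith
    then show ?thesis by simp
  qed
  have penalty_lower: "\<forall>\<^sub>F k in sequentially. \<alpha>lim * f xlim - e < \<alpha> k * f (x k)" if e: "0 < e" for e
  proof -
    \<comment> \<open>Half of \<open>e\<close> is spent on lowering \<open>f xlim\<close>, the other
      half on replacing \<open>\<alpha>lim\<close> by \<open>\<alpha> k\<close>; the sign of
      \<open>c\<close> does not matter.\<close>
    define c where "c = f xlim - e / (2 * \<alpha>lim)"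
    have "c < f xlim" using e \<alpha>lim_pos by (simp add: c_def)
    then have "\<forall>\<^sub>F k in sequentially. c < f (x k)"
      using weakly_lsc_on_lower[OF penalty(2) x(1)] xlimD xD DDf by (simp add: subset_iff)
    moreover have "\<alpha>lim * c = \<alpha>lim * f xlim - e / 2"
      using \<alpha>lim_pos by (simp add: c_def right_diff_distrib)
    then have "\<alpha>lim * f xlim - e < \<alpha>lim * c" using e by simp
    moreover have "(\<lambda>k. \<alpha> k * c) \<longlonglongrightarrow> \<alpha>lim * c" by (intro tendsto_intros \<alpha>(2))
    ultimately have "\<forall>\<^sub>F k in sequentially. \<alpha>lim * f xlim - e < \<alpha> k * c"
      "\<forall>\<^sub>F k in sequentially. c < f (x k)"
      by (auto dest: order_tendstoD)
    then show ?thesis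
    proof eventually_elim
      case (elim k)
      then show ?case
        using mult_strict_left_mono[OF elim(2) \<alpha>(1)[of k]] by linarith
    qed
  qed

  \<comment> \<open>Minimality of the limit and convergence of the residuals\<close>
  have "tikhonov F f ydelta p \<alpha>lim xlim \<le> tikhonov F f ydelta p \<alpha>lim z" if z: "z \<in> D" for z
  proof (rule field_le_epsilon)
    fix e :: real assume "0 < e"
    then have e: "0 < e / 3" "a - e / 3 < a" by simp_all
    \<comment> \<open>One third of \<open>e\<close> for each of the three estimates. The resulting
      inequality is free of \<open>k\<close>, so holding eventually means holding.\<close>
    have "\<forall>\<^sub>F k in sequentially. a + \<alpha>lim * f xlim \<le> tikhonov F f ydelta p \<alpha>lim z + e"
      using asymptotic[OF z e(1)] penalty_lower[OF e(1)] A_lower[OF e(2)]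
      by eventually_elim simp
    then show "tikhonov F f ydelta p \<alpha>lim xlim \<le> tikhonov F f ydelta p \<alpha>lim z + e"
      by (simp add: tik_lim)
  qed
  then have "is_arg_min (tikhonov F f ydelta p \<alpha>lim) (\<lambda>z. z \<in> D) xlim"
    using xlimD by (auto simp: is_arg_min_def not_less)
  moreover have A_tendsto: "A \<longlonglongrightarrow> a"
  proof (rule order_tendstoI)
    fix c assume c: "a < c"
    \<comment> \<open>The asymptotic bound at \<open>xlim\<close> and the lower bound for the
      penalty cost \<open>e\<close> each, leaving \<open>A k < a + 2 * e = c\<close>.\<close>
    define e where "e = (c - a) / 2"
    have e: "0 < e" using c by (simp add: e_def)
    show "\<forall>\<^sub>F k in sequentially. A k < c"
      using asymptotic[OF xlimD e] penalty_lower[OF e]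
      by eventually_elim (use tik_lim in \<open>simp add: e_def field_simps\<close>)
  qed (rule A_lower)
  \<comment> \<open>Roots turn this into convergence of the residual norms, which weak convergence
    of \<open>F (x k)\<close> alone would not give; both discrepancy bounds then pass to the
    limit.\<close>
  have "(\<lambda>k. A k powr (1 / p)) \<longlonglongrightarrow> a powr (1 / p)"
    using p by (intro tendsto_powr' A_tendsto tendsto_const) (auto simp: A_def)
  then have "(\<lambda>k. norm (F (x k) - ydelta)) \<longlonglongrightarrow> norm (F xlim - ydelta)"
    using p by (simp add: A_def a_def powr_powr)
  then have "\<tau> * \<delta> \<le> norm (F xlim - ydelta)" "norm (F xlim - ydelta) \<le> lam * \<delta>"
    using discrepancy by (auto intro: LIMSEQ_le_const LIMSEQ_le_const2)
  ultimately show ?thesis by blast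
qed

end
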